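(* Let $m\ge 4$ be even, $n=2^m$, let $K$ be a Kerdock code of length $n$, and let $K^*$ be the code of length $n-1$ obtained from $K$ by puncturing (deleting) one coordinate position. Let $i\in\{1,\ldots,n-1\}$ be a coordinate position of $K^*$. Then $K^*$ consists of exactly two $i$-components, and two codewords of $K^*$ are in the same $i$-component if the vectors obtained from them by deleting the $i$th coordinate have Hamming weights of the same parity.
   Context: A binary code of length $N$ is a subset of $\mathbb{F}^N=GF(2)^N$; $d(x,y)$ denotes Hamming distance; the minimum distance of a code is the smallest Hamming distance between two different codewords. Kerdock code: for even $m\ge 4$ and $n=2^m$, a Kerdock code $K$ is a binary code of length $n$ and minimum distance $d=(n-\sqrt n)/2$ which is the union of the first order Reed–Muller code $\mathrm{RM}(1,m)$ and $2^{m-1}-1$ further (distinct) cosets of $\mathrm{RM}(1,m)$, such that all codewords in each of these further cosets have weight $d$ or $n-d$. $i$-component: for a code $C$ with minimum distance $\delta$ and a coordinate position $i$, let $G_i(C)$ be the graph whose vertices are the codewords of $C$ and whose edges are the pairs $(x,y)$ of codewords with $d(x,y)=\delta$ and $x_i\ne y_i$. A connected component of $G_i(C)$ is called an $i$-component of $C$. *)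

theory Defs
  imports Complex_Main "HOL-Library.Z2" "Jordan_Normal_Form.Determinant"
begin

text \<open>
  Binary words of length \<open>N\<close> are elements of \<^term>\<open>carrier_vec N :: bit vec set\<close>.
  Coordinate positions are numbered from \<open>0\<close>.
\<close>

definition hamming_dist :: "bit vec \<Rightarrow> bit vec \<Rightarrow> nat" where
  "hamming_dist x y = card {j. j < dim_vec x \<and> x $ j \<noteq> y $ j}"

definition hamming_weight :: "bit vec \<Rightarrow> nat" where
  "hamming_weight x = card {j. j < dim_vec x \<and> x $ j \<noteq> 0}"

text \<open>Only meaningful for codes with at least two codewords.\<close>

definition min_distance :: "bit vec set \<Rightarrow> nat" where
  "min_distance C = (LEAST k. \<exists>x\<in>C. \<exists>y\<in>C. x \<noteq> y \<and> hamming_dist x y = k)"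

text \<open>
  The map \<^term>\<open>insert_index p\<close> is the increasing enumeration of the natural numbers
  other than \<open>p\<close>, so coordinate \<open>p\<close> is dropped and the later ones move down by one.
\<close>

definition delete_coord :: "nat \<Rightarrow> bit vec \<Rightarrow> bit vec" where
  "delete_coord p x = vec (dim_vec x - 1) (\<lambda>j. x $ insert_index p j)"

definition puncture :: "nat \<Rightarrow> bit vec set \<Rightarrow> bit vec set" where
  "puncture p C = delete_coord p ` C"

text \<open>
  Value tables of the affine functions \<open>GF(2)\<^sup>m \<Rightarrow> GF(2)\<close>; position \<open>j < 2 ^ m\<close>
  stands for the point of \<open>GF(2)\<^sup>m\<close> given by the binary digits of \<open>j\<close>.
\<close>

definition RM1 :: "nat \<Rightarrow> bit vec set" where
  "RM1 m = {vec (2 ^ m) (\<lambda>j. b + (\<Sum>k<m. a k * of_bool (bit j k))) | (a :: nat \<Rightarrow> bit) b. True}"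

definition RM1_cosets :: "nat \<Rightarrow> bit vec set set" where
  "RM1_cosets m = {(\<lambda>c. u + c) ` RM1 m | u. u \<in> carrier_vec (2 ^ m)}"

definition kerdock_dist :: "nat \<Rightarrow> nat" where
  "kerdock_dist m = (2 ^ m - 2 ^ (m div 2)) div 2"

lemma kerdock_dist_eq:
  assumes "even m" "m > 0"
  shows "real (kerdock_dist m) = (2 ^ m - sqrt (2 ^ m)) / 2"
proof -
  obtain k where k: "m = 2 * k" "k > 0"
    using assms by (auto elim: evenE)
  have "even ((2::nat) ^ m - 2 ^ k)"
    using k by simp
  moreover have "(2::nat) ^ k \<le> 2 ^ m"
    using k by (intro power_increasing) auto
  moreover have "sqrt (2 ^ m) = 2 ^ k"
    using k by (simp add: power_mult real_sqrt_power flip: power_mult_distrib)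
  ultimately show ?thesis
    using k by (simp add: kerdock_dist_def real_of_nat_div of_nat_diff)
qed

definition kerdock_code :: "nat \<Rightarrow> bit vec set \<Rightarrow> bool" where
  "kerdock_code m K \<longleftrightarrow>
     even m \<and> m \<ge> 4 \<and>
     min_distance K = kerdock_dist m \<and>
     (\<exists>S. S \<subseteq> RM1_cosets m - {RM1 m} \<and> card S = 2 ^ (m - 1) - 1 \<and>
          K = RM1 m \<union> \<Union> S \<and>
          (\<forall>B\<in>S. \<forall>x\<in>B. hamming_weight x = kerdock_dist m \<or>
                        hamming_weight x = 2 ^ m - kerdock_dist m))"

definition i_edges :: "nat \<Rightarrow> bit vec set \<Rightarrow> (bit vec \<times> bit vec) set" where
  "i_edges i C = {(x, y). x \<in> C \<and> y \<in> C \<and> hamming_dist x y = min_distance C \<and> x $ i \<noteq> y $ i}"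

text \<open>
  The edge relation is symmetric on words of equal length and contained in \<open>C \<times> C\<close>, so
  its reflexive transitive closure is reachability, whose classes are the connected components.
\<close>

definition i_components :: "nat \<Rightarrow> bit vec set \<Rightarrow> bit vec set set" where
  "i_components i C = C // (i_edges i C)\<^sup>*"

end

theory Submission
  imports Defs
begin

text \<open>
  Replace words by \<open>\<plusminus>1\<close> vectors, so that distances become inner products: with \<open>n = 2\<^sup>m\<close> and
  \<open>s = \<surd>n\<close>, distance \<open>(n - s) / 2\<close> means inner product \<open>s\<close>. Parseval in each coset, together with
  the minimum distance, forces inner products \<open>0\<close> inside a coset (except \<open>\<plusminus>n\<close>) and \<open>\<plusminus>s\<close>
  between different cosets. An edge of the \<open>i\<close>-graph of the punctured code joins words of \<open>K\<close> with
  inner product \<open>s\<close> that differ at both the punctured position \<open>p\<close> and the position \<open>q\<close> corresponding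
  to \<open>i\<close>; it preserves the product of the signs at \<open>p\<close> and \<open>q\<close>, which is the parity of the weight
  after both deletions, as all words of \<open>K\<close> have even weight.

  Conversely, every word has a neighbour in every other coset, and two words of one coset with equal
  signs at \<open>p\<close> and at \<open>q\<close> have a common neighbour. Both are proved by summing a nonnegative weight
  that vanishes off the neighbours. For the common neighbours this needs the fourth moments
  \<open>T j k = \<Sum>\<^sub>y y\<^sub>p y\<^sub>q y\<^sub>j y\<^sub>k\<close> over \<open>K\<close>: their sum of squares is \<open>2n\<^sup>4\<close>, which \<open>T p q\<close> and
  \<open>T q p\<close> already account for, so all others vanish.
\<close>

section \<open>Systems of sign vectors\<close>

text \<open>\<open>P\<close> models the cosets, \<open>e\<close> the signs, \<open>neg\<close> the
  complement and \<open>s\<close> the square root of the length. By \<open>orthogonal\<close>, each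
  block, read as a sign matrix with \<open>2 * n\<close> rows, has pairwise orthogonal
  columns.\<close>

locale sign_system =
  fixes n :: nat and s :: real and K :: "'v set" and P :: "'v set set"
    and e :: "'v \<Rightarrow> nat \<Rightarrow> real" and neg :: "'v \<Rightarrow> 'v"
  assumes s_sq: "s * s = real n" and s_ge: "s \<ge> 4"
    and finite_K: "finite K"
    and Union_P: "\<Union> P = K"
    and disjoint_P: "\<And>A B x. A \<in> P \<Longrightarrow> B \<in> P \<Longrightarrow> x \<in> A \<Longrightarrow> x \<in> B \<Longrightarrow> A = B"
    and card_P: "2 * card P = n"
    and card_block: "\<And>B. B \<in> P \<Longrightarrow> card B = 2 * n"
    and orthogonal: "\<And>B j k. B \<in> P \<Longrightarrow> j < n \<Longrightarrow> k < n \<Longrightarrow> j \<noteq> k \<Longrightarrow> (\<Sum>y\<in>B. e y j * e y k) = 0"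
    and sign: "\<And>x j. e x j = 1 \<or> e x j = -1"
    and neg_in: "\<And>B x. B \<in> P \<Longrightarrow> x \<in> B \<Longrightarrow> neg x \<in> B"
    and neg_neg: "\<And>x. x \<in> K \<Longrightarrow> neg (neg x) = x"
    and e_neg: "\<And>x j. x \<in> K \<Longrightarrow> j < n \<Longrightarrow> e (neg x) j = - e x j"
    and ip_bound: "\<And>x y. x \<in> K \<Longrightarrow> y \<in> K \<Longrightarrow> y \<noteq> x \<Longrightarrow> y \<noteq> neg x \<Longrightarrow>
                      \<bar>\<Sum>j<n. e x j * e y j\<bar> \<le> s"
begin

section \<open>Inner products within and between blocks\<close>

definition ip :: "'v \<Rightarrow> 'v \<Rightarrow> real" where
  "ip x y = (\<Sum>j<n. e x j * e y j)"

lemma n_ge: "n \<ge> 16"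
proof -
  have "4 * 4 \<le> s * s"
    using s_ge by (intro mult_mono) auto
  then show ?thesis
    using s_sq by simp
qed

lemma e_sq [simp]: "e x j * e x j = 1"
  using sign[of x j] by auto

lemma block_subset: "B \<in> P \<Longrightarrow> B \<subseteq> K"
  using Union_P by auto

lemma finite_block: "B \<in> P \<Longrightarrow> finite B"
  using block_subset finite_K finite_subset by blast

lemma finite_P: "finite P"
  using card_P n_ge card.infinite by fastforce

lemma sum_K: "(\<Sum>y\<in>K. f y) = (\<Sum>B\<in>P. \<Sum>y\<in>B. f y)" for f :: "'v \<Rightarrow> real"
  unfolding Union_P[symmetric]
  by (subst sum.Union_disjoint) (use disjoint_P finite_block in auto)

lemma card_K: "real (card K) = real n * real n"
proof -
  have "real (card K) = (\<Sum>y\<in>K. 1)"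
    by simp
  also have "\<dots> = (\<Sum>B\<in>P. real (2 * n))"
    unfolding sum_K by (intro sum.cong) (auto simp: card_block)
  also have "\<dots> = real (2 * card P) * real n"
    by simp
  finally show ?thesis
    unfolding card_P .
qed

lemma ip_self [simp]: "ip x x = real n"
  by (simp add: ip_def)

text \<open>Isolates the dependence on \<open>y\<close> in \<open>e y j * e y k\<close>, so that
  sums over \<open>y\<close> reduce to moments of the columns.\<close>

lemma ip_mult_ip: "ip x y * ip z y = (\<Sum>j<n. \<Sum>k<n. e x j * e z k * (e y j * e y k))"
  unfolding ip_def sum_product by (intro sum.cong refl) (simp only: mult_ac)

lemma ip_commute: "ip x y = ip y x"
  by (simp add: ip_def mult.commute)

lemma ip_neg: "y \<in> K \<Longrightarrow> ip x (neg y) = - ip x y"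
  by (simp add: ip_def e_neg sum_negf)

lemma neg_neq: "x \<in> K \<Longrightarrow> neg x \<noteq> x"
  using e_neg[of x 0] n_ge sign[of x 0] by auto

text \<open>\<open>neg\<close> permutes the block, so the sum equals its own negative.\<close>

lemma sum_odd:
  fixes f :: "'v \<Rightarrow> real"
  assumes B: "B \<in> P" and odd: "\<And>y. y \<in> B \<Longrightarrow> f (neg y) = - f y"
  shows "(\<Sum>y\<in>B. f y) = 0"
proof -
  have "bij_betw neg B B"
    by (rule bij_betwI[where g = neg])
       (use B neg_in neg_neg block_subset[OF B] in auto)
  then have "(\<Sum>y\<in>B. f (neg y)) = (\<Sum>y\<in>B. f y)"
    by (rule sum.reindex_bij_betw)
  then show ?thesis
    using odd by (simp add: sum_negf)
qed

lemma gram_block: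
  assumes "B \<in> P" "j < n" "k < n"
  shows "(\<Sum>y\<in>B. e y j * e y k) = (if j = k then 2 * real n else 0)"
  using assms by (auto simp: orthogonal card_block)

lemma sum_e_ip:
  assumes "B \<in> P" "j < n"
  shows "(\<Sum>y\<in>B. e y j * ip x y) = 2 * real n * e x j"
proof -
  have "(\<Sum>y\<in>B. e y j * ip x y) = (\<Sum>k<n. \<Sum>y\<in>B. e x k * (e y j * e y k))"
    unfolding ip_def sum_distrib_left
    by (subst sum.swap) (simp add: mult_ac)
  also have "\<dots> = (\<Sum>k<n. if j = k then 2 * real n * e x k else 0)"
    using assms by (intro sum.cong) (auto simp: gram_block simp flip: sum_distrib_left)
  finally show ?thesis
    using assms by simp
qed

text \<open>Orthogonal columns of squared norm \<open>2 * n\<close> make every block a tight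
  frame.\<close>

lemma parseval:
  assumes "B \<in> P"
  shows "(\<Sum>y\<in>B. ip x y * ip z y) = 2 * real n * ip x z"
proof -
  have "(\<Sum>y\<in>B. ip x y * ip z y) = (\<Sum>y\<in>B. \<Sum>j<n. e x j * (e y j * ip z y))"
    by (subst (1) ip_def) (simp only: sum_distrib_right mult.assoc)
  also have "\<dots> = (\<Sum>j<n. e x j * (\<Sum>y\<in>B. e y j * ip z y))"
    by (subst sum.swap) (simp add: sum_distrib_left)
  also have "\<dots> = (\<Sum>j<n. e x j * (2 * real n * e z j))"
    using assms by (intro sum.cong refl) (simp only: sum_e_ip lessThan_iff)
  also have "\<dots> = 2 * real n * ip x z"
    by (simp add: ip_def sum_distrib_left mult_ac)
  finally show ?thesis .
qed

text \<open>\<open>x\<close> and \<open>neg x\<close> already exhaust the Parseval sum over their own block.\<close>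

lemma ip_same_block:
  assumes A: "A \<in> P" "x \<in> A" "y \<in> A" and ne: "y \<noteq> x" "y \<noteq> neg x"
  shows "ip x y = 0"
proof -
  have K: "x \<in> K"
    using A block_subset by auto
  have "(\<Sum>y\<in>A. ip x y * ip x y) =
        (\<Sum>y\<in>{x, neg x}. ip x y * ip x y) + (\<Sum>y\<in>A - {x, neg x}. ip x y * ip x y)"
    using A neg_in finite_block by (subst add.commute, intro sum.subset_diff) auto
  then have "(\<Sum>y\<in>A - {x, neg x}. ip x y * ip x y) = 0"
    using A K neg_neq[of x] by (simp add: parseval ip_neg)
  then have "\<forall>y\<in>A - {x, neg x}. ip x y * ip x y = 0"
    using finite_block[OF A(1)] by (subst (asm) sum_nonneg_eq_0_iff) auto
  then show ?thesis
    using A ne by auto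
qed

text \<open>By \<open>parseval\<close> the \<open>2 * n\<close> squares over \<open>B\<close> have
  average \<open>n\<close>, while \<open>ip_bound\<close> caps each of them at
  \<open>s * s = n\<close>; hence all attain the cap.\<close>

lemma ip_other_block_sq:
  assumes "A \<in> P" "x \<in> A" "B \<in> P" "y \<in> B" "A \<noteq> B"
  shows "ip x y * ip x y = real n"
proof -
  have K: "x \<in> K" "neg x \<in> A"
    using assms block_subset neg_in by auto
  have le: "ip x z * ip x z \<le> real n" if "z \<in> B" for z
  proof -
    have "\<bar>ip x z\<bar> \<le> s"
      unfolding ip_def using ip_bound[of x z] assms K that block_subset disjoint_P by blast
    then have "\<bar>ip x z\<bar> * \<bar>ip x z\<bar> \<le> s * s"
      by (intro mult_mono) auto
    then show ?thesis
      by (simp add: s_sq)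
  qed
  have "(\<Sum>z\<in>B. real n - ip x z * ip x z) = 0"
    using assms by (simp add: sum_subtractf parseval card_block)
  then have "\<forall>z\<in>B. real n - ip x z * ip x z = 0"
    using finite_block[OF assms(3)] le by (subst (asm) sum_nonneg_eq_0_iff) auto
  then show ?thesis
    using assms by auto
qed

lemma ip_other_block:
  assumes "A \<in> P" "x \<in> A" "B \<in> P" "y \<in> B" "A \<noteq> B"
  shows "ip x y = s \<or> ip x y = - s"
proof -
  have "(ip x y - s) * (ip x y + s) = 0"
    using ip_other_block_sq[OF assms] s_sq by (simp add: algebra_simps)
  then show ?thesis
    by auto
qed

lemma blockE:
  assumes "x \<in> K"
  obtains A where "A \<in> P" "x \<in> A"
  using assms Union_P by auto

lemma ip_values:
  assumes "x \<in> K" "y \<in> K"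
  shows "ip x y \<in> {real n, - real n, 0, s, - s}"
proof -
  obtain A B where "A \<in> P" "x \<in> A" "B \<in> P" "y \<in> B"
    using assms blockE by metis
  then show ?thesis
    using ip_same_block[of A x y] ip_other_block[of A x B y] assms
    by (cases "y = x"; cases "y = neg x"; cases "A = B") (auto simp: ip_neg)
qed

end

section \<open>Two coordinates\<close>

locale sign_system_pair = sign_system +
  fixes p q :: nat
  assumes p: "p < n" and q: "q < n" and pq: "p \<noteq> q"
begin

section \<open>Fourth moments\<close>

definition T :: "nat \<Rightarrow> nat \<Rightarrow> real" where
  "T j k = (\<Sum>y\<in>K. e y p * e y q * (e y j * e y k))"

text \<open>Expanding the squares gives a double sum over \<open>x\<close> and \<open>y\<close> in
  which the sums over \<open>j\<close> and \<open>k\<close> collapse to the square of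
  \<open>ip x y\<close>. Each of the \<open>n * n\<close> elements \<open>x\<close> then contributes
  \<open>2 * (n * n)\<close>.\<close>

lemma sum_T_sq: "(\<Sum>j<n. \<Sum>k<n. T j k * T j k) = 2 * (real n ^ 4)"
proof -
  have row: "(\<Sum>y\<in>K. e x p * e x q * (e y p * e y q) * (ip x y * ip x y)) = 2 * (real n * real n)"
    (is "(\<Sum>y\<in>K. ?f y) = _") if x: "x \<in> K" for x
  proof -
    obtain A where A: "A \<in> P" "x \<in> A"
      using x by (rule blockE)
    \<comment> \<open>On another block the squared inner product is constantly \<open>n\<close>, so
      orthogonality of columns \<open>p\<close> and \<open>q\<close> kills the sum.\<close>
    have "(\<Sum>y\<in>B. ?f y) = 0" if B: "B \<in> P" "B \<noteq> A" for B
    proof -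
      have "(\<Sum>y\<in>B. ?f y) = (\<Sum>y\<in>B. e x p * e x q * real n * (e y p * e y q))"
        using A B ip_other_block_sq[of A x B] by (intro sum.cong) auto
      also have "\<dots> = 0"
        using B p q pq by (simp add: orthogonal flip: sum_distrib_left)
      finally show ?thesis .
    qed
    then have "(\<Sum>y\<in>K. ?f y) = (\<Sum>y\<in>A. ?f y)"
      unfolding sum_K using A finite_P by (subst sum.remove[of _ A]) auto
    \<comment> \<open>Within its own block, \<open>x\<close> is orthogonal to everything except
      \<open>x\<close> and \<open>neg x\<close>.\<close>
    also have "\<dots> = (\<Sum>y\<in>{x, neg x}. ?f y)"
      using A neg_in ip_same_block[of A x] finite_block by (intro sum.mono_neutral_right) auto
    also have "\<dots> = 2 * (real n * real n)"
      using x neg_neq[OF x] p q sign[of x p] sign[of x q] by (auto simp: ip_neg e_neg)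
    finally show ?thesis .
  qed
  \<comment> \<open>The interchanges below move both sums over \<open>K\<close> outside those over
    \<open>j\<close> and \<open>k\<close>.\<close>
  have "(\<Sum>j<n. \<Sum>k<n. T j k * T j k) =
      (\<Sum>j<n. \<Sum>k<n. \<Sum>x\<in>K. \<Sum>y\<in>K. e x p * e x q * (e x j * e x k) * (e y p * e y q * (e y j * e y k)))"
    by (simp add: T_def sum_product)
  also have "\<dots> = (\<Sum>j<n. \<Sum>x\<in>K. \<Sum>k<n. \<Sum>y\<in>K. e x p * e x q * (e x j * e x k) * (e y p * e y q * (e y j * e y k)))"
    by (intro sum.cong refl sum.swap)
  also have "\<dots> = (\<Sum>x\<in>K. \<Sum>j<n. \<Sum>k<n. \<Sum>y\<in>K. e x p * e x q * (e x j * e x k) * (e y p * e y q * (e y j * e y k)))"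
    by (rule sum.swap)
  also have "\<dots> = (\<Sum>x\<in>K. \<Sum>j<n. \<Sum>y\<in>K. \<Sum>k<n. e x p * e x q * (e x j * e x k) * (e y p * e y q * (e y j * e y k)))"
    by (intro sum.cong refl sum.swap)
  also have "\<dots> = (\<Sum>x\<in>K. \<Sum>y\<in>K. \<Sum>j<n. \<Sum>k<n. e x p * e x q * (e x j * e x k) * (e y p * e y q * (e y j * e y k)))"
    by (intro sum.cong refl sum.swap)
  also have "\<dots> = (\<Sum>x\<in>K. \<Sum>y\<in>K. e x p * e x q * (e y p * e y q) * (ip x y * ip x y))"
    unfolding ip_mult_ip sum_distrib_left by (intro sum.cong refl) (simp only: mult_ac)
  also have "\<dots> = (\<Sum>x\<in>K. 2 * (real n * real n))"
    by (intro sum.cong refl row)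
  also have "\<dots> = 2 * (real n ^ 4)"
    by (simp add: card_K power4_eq_xxxx)
  finally show ?thesis .
qed

lemma T_pq: "T p q = real n * real n" "T q p = real n * real n"
proof -
  have "e y p * e y q * (e y p * e y q) = 1" "e y p * e y q * (e y q * e y p) = 1" for y
    using sign[of y p] sign[of y q] by auto
  then show "T p q = real n * real n" "T q p = real n * real n"
    by (simp_all add: T_def card_K)
qed

text \<open>The two obvious entries of \<^const>\<open>T\<close> already exhaust the sum of squares.\<close>

lemma T_eq_0:
  assumes "j < n" "k < n" "(j, k) \<noteq> (p, q)" "(j, k) \<noteq> (q, p)"
  shows "T j k = 0"
proof -
  let ?I = "{..<n} \<times> {..<n}"
  let ?f = "\<lambda>(j, k). T j k * T j k"
  have "(\<Sum>i\<in>?I. ?f i) = 2 * (real n ^ 4)"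
    using sum_T_sq by (simp add: sum.cartesian_product)
  moreover have "(\<Sum>i\<in>?I. ?f i) = (\<Sum>i\<in>?I - {(p, q), (q, p)}. ?f i) + (\<Sum>i\<in>{(p, q), (q, p)}. ?f i)"
    using p q by (intro sum.subset_diff) auto
  moreover have "(\<Sum>i\<in>{(p, q), (q, p)}. ?f i) = 2 * (real n ^ 4)"
    using pq by (simp add: T_pq power4_eq_xxxx)
  ultimately have "(\<Sum>i\<in>?I - {(p, q), (q, p)}. ?f i) = 0"
    by simp
  then have "\<forall>i\<in>?I - {(p, q), (q, p)}. ?f i = 0"
    by (subst (asm) sum_nonneg_eq_0_iff) auto
  from bspec[OF this, of "(j, k)"] show ?thesis
    using assms by auto
qed

text \<open>Summing over \<open>y\<close> first turns the expansion into a combination of the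
  moments \<open>T j k\<close>, of which only \<open>T p q\<close> and \<open>T q p\<close>
  survive.\<close>

lemma sum_pq_ip_ip:
  "(\<Sum>y\<in>K. e y p * e y q * (ip x y * ip z y)) = real n * real n * (e x p * e z q + e x q * e z p)"
proof -
  have "(\<Sum>y\<in>K. e y p * e y q * (ip x y * ip z y)) =
        (\<Sum>y\<in>K. \<Sum>j<n. \<Sum>k<n. e x j * e z k * (e y p * e y q * (e y j * e y k)))"
    unfolding ip_mult_ip sum_distrib_left by (intro sum.cong refl) (simp only: mult_ac)
  also have "\<dots> = (\<Sum>j<n. \<Sum>y\<in>K. \<Sum>k<n. e x j * e z k * (e y p * e y q * (e y j * e y k)))"
    by (rule sum.swap)
  also have "\<dots> = (\<Sum>j<n. \<Sum>k<n. e x j * e z k * T j k)"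
    unfolding T_def sum_distrib_left by (intro sum.cong refl sum.swap)
  also have "\<dots> = (\<Sum>(j, k)\<in>{..<n} \<times> {..<n}. e x j * e z k * T j k)"
    by (simp add: sum.cartesian_product)
  also have "\<dots> = (\<Sum>(j, k)\<in>{(p, q), (q, p)}. e x j * e z k * T j k)"
  proof (intro sum.mono_neutral_right ballI)
    fix i
    assume "i \<in> {..<n} \<times> {..<n} - {(p, q), (q, p)}"
    then show "(case i of (j, k) \<Rightarrow> e x j * e z k * T j k) = 0"
      using T_eq_0[of "fst i" "snd i"] by (auto simp: case_prod_beta prod_eq_iff)
  qed (use p q in auto)
  also have "\<dots> = real n * real n * (e x p * e z q + e x q * e z p)"
    using pq by (simp add: T_pq algebra_simps)
  finally show ?thesis .
qed

section \<open>Weighted sums detecting opposite signs at both positions\<close>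

definition W :: "'a \<Rightarrow> 'a \<Rightarrow> real" where
  "W x y = (1 - e x p * e y p) * (1 - e x q * e y q)"

lemma W_expand: "W x y = 1 - e x p * e y p - e x q * e y q + e x p * e x q * (e y p * e y q)"
  by (simp add: W_def algebra_simps)

text \<open>Each factor of \<open>W\<close> is 0 or 2, so \<open>W x y\<close> is 4 if
  \<open>y\<close> is opposite to \<open>x\<close> at both positions and 0 otherwise.\<close>

lemma W_neq_0: "W x y \<noteq> 0 \<Longrightarrow> e y p = - e x p \<and> e y q = - e x q"
  unfolding W_def using sign[of x p] sign[of y p] sign[of x q] sign[of y q] by auto

text \<open>In \<open>W_expand\<close> the linear terms are odd under \<open>neg\<close> and the
  quadratic one vanishes by orthogonality, which leaves the constant.\<close>

lemma sum_W:
  assumes B: "B \<in> P"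
  shows "(\<Sum>y\<in>B. W x y) = 2 * real n"
proof -
  have "(\<Sum>y\<in>B. e y j) = 0" if "j < n" for j
    using B that by (intro sum_odd) (auto simp: e_neg subsetD[OF block_subset])
  then show ?thesis
    using B p q pq
    by (simp add: W_expand sum_subtractf sum.distrib card_block orthogonal flip: sum_distrib_left)
qed

text \<open>The extra factor \<open>ip z y\<close> reverses the parities: now the constant and
  quadratic terms are odd, and each linear term gives \<open>- 2 * n\<close> by
  \<open>sum_e_ip\<close>.\<close>

lemma sum_W_ip:
  assumes B: "B \<in> P" and same: "e x p = e z p" "e x q = e z q"
  shows "(\<Sum>y\<in>B. W x y * ip z y) = - 4 * real n"
proof -
  have odd: "(\<Sum>y\<in>B. ip z y) = 0" "(\<Sum>y\<in>B. e y p * e y q * ip z y) = 0"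
    using B p q block_subset by (auto intro!: sum_odd simp: e_neg ip_neg subset_iff)
  have "(\<Sum>y\<in>B. W x y * ip z y) = (\<Sum>y\<in>B. ip z y) - e x p * (\<Sum>y\<in>B. e y p * ip z y)
      - e x q * (\<Sum>y\<in>B. e y q * ip z y) + e x p * e x q * (\<Sum>y\<in>B. e y p * e y q * ip z y)"
    by (simp add: W_expand algebra_simps sum_subtractf sum.distrib sum_distrib_left)
  also have "\<dots> = - 2 * real n * (e x p * e z p) - 2 * real n * (e x q * e z q)"
    using B p q by (simp add: odd sum_e_ip)
  finally show ?thesis
    using same by simp
qed

text \<open>The linear terms are odd, the constant one vanishes by \<open>parseval\<close>, and the
  quadratic one is evaluated by the fourth moments. These are moments over all of \<open>K\<close>,
  so this sum is not taken block by block.\<close>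

lemma sum_W_ip_ip:
  assumes same: "e x p = e z p" "e x q = e z q" and orth: "ip x z = 0"
  shows "(\<Sum>y\<in>K. W x y * (ip x y * ip z y)) = 2 * (real n * real n)"
proof -
  have odd: "(\<Sum>y\<in>K. e y j * (ip x y * ip z y)) = 0" if "j < n" for j
    unfolding sum_K using that block_subset
    by (intro sum.neutral ballI sum_odd) (auto simp: e_neg ip_neg subset_iff)
  have "(\<Sum>y\<in>K. ip x y * ip z y) = 0"
    unfolding sum_K by (simp add: parseval orth)
  moreover have "(\<Sum>y\<in>K. W x y * (ip x y * ip z y)) =
      (\<Sum>y\<in>K. ip x y * ip z y)
      - e x p * (\<Sum>y\<in>K. e y p * (ip x y * ip z y))
      - e x q * (\<Sum>y\<in>K. e y q * (ip x y * ip z y))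
      + e x p * e x q * (\<Sum>y\<in>K. e y p * e y q * (ip x y * ip z y))"
    by (simp add: W_expand algebra_simps sum_subtractf sum.distrib sum_distrib_left)
  ultimately have "(\<Sum>y\<in>K. W x y * (ip x y * ip z y)) =
      e x p * e x q * (real n * real n * (e x p * e z q + e x q * e z p))"
    using p q by (simp add: odd sum_pq_ip_ip)
  then show ?thesis
    using same sign[of z p] sign[of z q] by auto
qed

section \<open>Neighbours and reachability\<close>

definition adj :: "('a \<times> 'a) set" where
  "adj = {(x, y). x \<in> K \<and> y \<in> K \<and> ip x y = s \<and> e y p = - e x p \<and> e y q = - e x q}"

lemma adj_sym: "(x, y) \<in> adj \<Longrightarrow> (y, x) \<in> adj"
  by (auto simp: adj_def ip_commute)

text \<open>On \<open>B\<close> the factor \<open>s + ip x y\<close> is 0 or \<open>2 * s\<close>,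
  so \<open>W x y * (s + ip x y)\<close> is nonzero only at neighbours of \<open>x\<close>, and its
  sum \<open>2 * n * (s - 2)\<close> is positive.\<close>

lemma neighbour:
  assumes "A \<in> P" "x \<in> A" "B \<in> P" "A \<noteq> B"
  obtains y where "y \<in> B" "(x, y) \<in> adj"
proof -
  have "(\<Sum>y\<in>B. W x y * (s + ip x y)) = s * (\<Sum>y\<in>B. W x y) + (\<Sum>y\<in>B. W x y * ip x y)"
    by (simp add: algebra_simps sum.distrib sum_distrib_left)
  also have "\<dots> = 2 * real n * (s - 2)"
    by (simp only: sum_W[OF assms(3)] sum_W_ip[OF assms(3) refl refl]) (simp add: algebra_simps)
  also have "\<dots> \<noteq> 0"
    using n_ge s_ge by simp
  finally obtain y where y: "y \<in> B" "W x y * (s + ip x y) \<noteq> 0"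
    by (meson sum.neutral)
  then have "ip x y = s"
    using ip_other_block[OF assms(1-3) y(1) assms(4)] by auto
  then have "(x, y) \<in> adj"
    using y assms W_neq_0[of x y] block_subset by (auto simp: adj_def)
  with y show thesis
    using that by blast
qed

text \<open>Outside \<open>A\<close> the weight \<open>?f\<close> is nonzero only at common
  neighbours, since \<open>W x\<close> and \<open>W z\<close> agree. Its sum over \<open>K\<close>
  exceeds its sum over \<open>A\<close>.\<close>

lemma common_neighbour:
  assumes A: "A \<in> P" "x \<in> A" "z \<in> A" and ne: "x \<noteq> z" and same: "e x p = e z p" "e x q = e z q"
  obtains y where "(x, y) \<in> adj" "(z, y) \<in> adj"
proof -
  let ?f = "\<lambda>y. W x y * ((s + ip x y) * (s + ip z y))"
  have K: "x \<in> K" "z \<in> K"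
    using A block_subset by auto
  have ne': "z \<noteq> neg x"
    using e_neg[OF K(1) p] same sign[of x p] by auto
  have orth: "ip x z = 0"
    using A ne ne' ip_same_block by blast
  \<comment> \<open>Either \<open>y\<close> is \<open>x\<close> or \<open>neg x\<close>, hence
    orthogonal to \<open>z\<close>, or \<open>y\<close> is orthogonal to \<open>x\<close>.\<close>
  have zero: "ip x y * ip z y = 0" if "y \<in> A" for y
  proof (cases "y = x \<or> y = neg x")
    case True
    then show ?thesis
      using K orth by (auto simp: ip_neg ip_commute[of z x])
  next
    case False
    then show ?thesis
      using A that ip_same_block by auto
  qed
  have expand: "(\<Sum>y\<in>B. ?f y) = s * s * (\<Sum>y\<in>B. W x y)
      + s * (\<Sum>y\<in>B. W x y * ip x y) + s * (\<Sum>y\<in>B. W x y * ip z y)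
      + (\<Sum>y\<in>B. W x y * (ip x y * ip z y))" for B
    by (simp add: algebra_simps sum.distrib sum_distrib_left)
  have block: "(\<Sum>y\<in>B. ?f y) = 2 * real n * real n - 8 * s * real n
      + (\<Sum>y\<in>B. W x y * (ip x y * ip z y))" if "B \<in> P" for B
    unfolding expand using that same s_sq by (simp add: sum_W sum_W_ip)
  have "(\<Sum>y\<in>A. ?f y) = 2 * real n * real n - 8 * s * real n"
    using A block zero by (simp add: sum.neutral del: mult_eq_0_iff)
  moreover have "(\<Sum>y\<in>K. ?f y) =
      real (card P) * (2 * real n * real n - 8 * s * real n) + 2 * (real n * real n)"
    unfolding sum_W_ip_ip[OF same orth, symmetric] sum_K
    by (simp add: block sum.distrib)
  moreover have "(\<Sum>y\<in>K. ?f y) = (\<Sum>y\<in>K - A. ?f y) + (\<Sum>y\<in>A. ?f y)"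
    using A block_subset finite_K by (intro sum.subset_diff) auto
  moreover have "real (card P) = real n / 2"
    using card_P by linarith
  ultimately have "(\<Sum>y\<in>K - A. ?f y) = real n * (real n * (real n - 4 * s) + 8 * s)"
    by (simp add: algebra_simps)
  \<comment> \<open>This is where \<open>s \<ge> 4\<close> enters. For \<open>s = 4\<close> the
    factor vanishes, and positivity comes from the term \<open>8 * s\<close>.\<close>
  also have "real n - 4 * s = s * (s - 4)"
    by (simp add: algebra_simps s_sq)
  also have "real n * (real n * (s * (s - 4)) + 8 * s) > 0"
    using n_ge s_ge by (intro mult_pos_pos add_nonneg_pos mult_nonneg_nonneg) auto
  finally have "(\<Sum>y\<in>K - A. ?f y) \<noteq> 0"
    by (rule less_imp_neq[symmetric])
  then obtain y where y: "y \<in> K - A" "?f y \<noteq> 0"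
    by (meson sum.neutral)
  obtain B where B: "B \<in> P" "y \<in> B"
    using y blockE by blast
  then have "A \<noteq> B"
    using y by auto
  then have "ip x y = s" "ip z y = s"
    using ip_other_block[of A x B y] ip_other_block[of A z B y] A B y by auto
  then have "(x, y) \<in> adj" "(z, y) \<in> adj"
    using y A same W_neq_0[of x y] block_subset by (auto simp: adj_def)
  then show thesis
    using that by blast
qed

text \<open>Inside a block a common neighbour gives a path. Otherwise two edges through a third
  block lead into the block of \<open>z\<close>; the signs at \<open>p\<close> and \<open>q\<close>
  are flipped twice, which reduces to the first case.\<close>

lemma reach_same_signs:
  assumes "x \<in> K" "z \<in> K" "e x p = e z p" "e x q = e z q"
  shows "(x, z) \<in> adj\<^sup>*"
proof -
  have same_block: "(x, z) \<in> adj\<^sup>*"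
    if *: "A \<in> P" "x \<in> A" "z \<in> A" "e x p = e z p" "e x q = e z q" for A x z
  proof (cases "x = z")
    case False
    then obtain y where "(x, y) \<in> adj" "(z, y) \<in> adj"
      using common_neighbour[OF *(1-3) False *(4,5)] by blast
    then have "(x, y) \<in> adj\<^sup>*" "(y, z) \<in> adj\<^sup>*"
      by (auto dest: adj_sym)
    then show ?thesis
      by (rule rtrancl_trans)
  qed auto
  obtain A B where AB: "A \<in> P" "x \<in> A" "B \<in> P" "z \<in> B"
    using assms blockE by metis
  show ?thesis
  proof (cases "A = B")
    case True
    then show ?thesis
      using same_block[OF AB(1,2)] AB assms by simp
  next
    case False
    have "\<not> P \<subseteq> {A, B}"
    proof
      assume "P \<subseteq> {A, B}"
      then have "card P \<le> card {A, B}"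
        by (intro card_mono) auto
      also have "\<dots> \<le> 2"
        by (simp add: card_insert_if)
      finally show False
        using card_P n_ge by simp
    qed
    then obtain C where C: "C \<in> P" "C \<noteq> A" "C \<noteq> B"
      by auto
    obtain y where y: "y \<in> C" "(x, y) \<in> adj"
      using neighbour[OF AB(1,2) C(1)] C by blast
    obtain w where w: "w \<in> B" "(y, w) \<in> adj"
      using neighbour[OF C(1) y(1) AB(3)] C by blast
    have "e w p = e z p" "e w q = e z q"
      using y w assms by (auto simp: adj_def)
    then have "(w, z) \<in> adj\<^sup>*"
      using same_block[OF AB(3) w(1) AB(4)] by simp
    then show ?thesis
      using converse_rtrancl_into_rtrancl[OF y(2) converse_rtrancl_into_rtrancl[OF w(2)]] by blast
  qed
qed

lemma exists_neighbour:
  assumes "x \<in> K"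
  obtains y where "(x, y) \<in> adj"
proof -
  obtain A where A: "A \<in> P" "x \<in> A"
    using assms blockE by blast
  have "\<not> P \<subseteq> {A}"
    using card_P n_ge card_mono[of "{A}" P] by auto
  then obtain B where "B \<in> P" "B \<noteq> A"
    by auto
  then show thesis
    using neighbour[OF A, of B] that by blast
qed

text \<open>Equal products mean that the sign pairs agree or are opposite; in the latter case one
  edge flips both signs.\<close>

lemma reach:
  assumes "x \<in> K" "z \<in> K" "e x p * e x q = e z p * e z q"
  shows "(x, z) \<in> adj\<^sup>*"
proof (cases "e x p = e z p")
  case True
  then have "e x q = e z q"
    using assms sign[of z p] by auto
  then show ?thesis
    using True assms reach_same_signs by blast
next
  case False
  then have opp: "e z p = - e x p" "e z q = - e x q"
    using assms sign[of z p] sign[of x p] sign[of z q] sign[of x q] by auto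
  obtain y where y: "(x, y) \<in> adj"
    using assms exists_neighbour by blast
  then have "(y, z) \<in> adj\<^sup>*"
    using assms opp reach_same_signs[of y z] by (auto simp: adj_def)
  then show ?thesis
    by (rule converse_rtrancl_into_rtrancl[OF y])
qed

lemma reach_product: "(x, z) \<in> adj\<^sup>* \<Longrightarrow> e x p * e x q = e z p * e z q"
  by (induction rule: rtrancl_induct) (auto simp: adj_def)

text \<open>The products are signs that sum to zero over a nonempty block, so both values occur.
  This makes both components nonempty.\<close>

lemma exists_product:
  assumes "B \<in> P"
  obtains x y where "x \<in> B" "y \<in> B" "e x p * e x q = 1" "e y p * e y q = -1"
proof -
  have sum: "(\<Sum>y\<in>B. e y p * e y q) = 0"
    using assms p q pq by (simp add: orthogonal)
  have card: "card B > 0"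
    using assms n_ge by (simp add: card_block)
  have sg: "e x p * e x q = 1 \<or> e x p * e x q = -1" for x
    using sign[of x p] sign[of x q] by auto
  have "\<exists>x\<in>B. e x p * e x q = 1"
  proof (rule ccontr)
    assume "\<not> ?thesis"
    then have "(\<Sum>y\<in>B. e y p * e y q) = (\<Sum>y\<in>B. -1)"
      using sg by (intro sum.cong) auto
    then show False
      using sum card by simp
  qed
  moreover have "\<exists>x\<in>B. e x p * e x q = -1"
  proof (rule ccontr)
    assume "\<not> ?thesis"
    then have "(\<Sum>y\<in>B. e y p * e y q) = (\<Sum>y\<in>B. 1)"
      using sg by (intro sum.cong) auto
    then show False
      using sum card by simp
  qed
  ultimately show thesis
    using that by blast
qed

end

section \<open>Cosets of the first order Reed--Muller code\<close>

text \<open>These simplification rules would replace field arithmetic by bit operations.\<close>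

declare add_bit_eq_xor [simp del] mult_bit_eq_and [simp del]

lemma bit_add_self [simp]: "b + b = 0" for b :: bit
  by (cases b) auto

lemma bit_cases: "b = 0 \<or> b = 1" for b :: bit
  by (cases b) auto

definition affine_word :: "nat \<Rightarrow> (nat \<Rightarrow> bit) \<Rightarrow> bit \<Rightarrow> bit vec" where
  "affine_word m a b = vec (2 ^ m) (\<lambda>j. b + (\<Sum>k<m. a k * of_bool (bit j k)))"

lemma affine_word_carrier [simp]: "affine_word m a b \<in> carrier_vec (2 ^ m)"
  by (simp add: affine_word_def)

lemma RM1_eq: "RM1 m = {affine_word m a b | a b. True}"
  by (simp add: RM1_def affine_word_def)

lemma affine_word_in_RM1 [simp]: "affine_word m a b \<in> RM1 m"
  by (auto simp: RM1_eq)

lemma RM1_carrier: "RM1 m \<subseteq> carrier_vec (2 ^ m)"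
  by (auto simp: RM1_eq)

lemma affine_word_add:
  "affine_word m a b + affine_word m a' b' = affine_word m (\<lambda>k. a k + a' k) (b + b')"
proof (rule eq_vecI)
  fix j
  assume "j < dim_vec (affine_word m (\<lambda>k. a k + a' k) (b + b'))"
  then have j: "j < 2 ^ m"
    by (simp add: affine_word_def)
  have "(\<Sum>k<m. (a k + a' k) * of_bool (bit j k)) =
      (\<Sum>k<m. a k * of_bool (bit j k)) + (\<Sum>k<m. a' k * of_bool (bit j k))"
    by (simp only: distrib_right sum.distrib)
  then show "(affine_word m a b + affine_word m a' b') $ j = affine_word m (\<lambda>k. a k + a' k) (b + b') $ j"
    using j unfolding affine_word_def by (simp only: index_vec dim_vec index_add_vec add_ac)
qed (simp add: affine_word_def)

lemma RM1_add: "c \<in> RM1 m \<Longrightarrow> c' \<in> RM1 m \<Longrightarrow> c + c' \<in> RM1 m"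
  unfolding RM1_eq using affine_word_add by blast

lemma zero_in_RM1: "0\<^sub>v (2 ^ m) \<in> RM1 m"
proof -
  have "0\<^sub>v (2 ^ m) = affine_word m (\<lambda>_. 0) 0"
    unfolding affine_word_def by (rule eq_vecI) simp_all
  then show ?thesis
    by simp
qed

lemma affine_word_at_0: "affine_word m a b $ 0 = b"
proof -
  have "(\<Sum>k<m. a k * of_bool (bit (0 :: nat) k)) = 0"
    by (intro sum.neutral) simp
  moreover have "affine_word m a b $ 0 = b + (\<Sum>k<m. a k * of_bool (bit (0 :: nat) k))"
    unfolding affine_word_def by (rule index_vec) simp
  ultimately show ?thesis
    by (simp only: add_0_right)
qed

text \<open>Position \<open>2 ^ k\<close> is the \<open>k\<close>-th unit vector. With position 0
  these values recover all coefficients, as \<open>card_RM1\<close> requires.\<close>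

lemma affine_word_at_power:
  assumes "k < m"
  shows "affine_word m a b $ (2 ^ k) = b + a k"
proof -
  have "(\<Sum>i<m. a i * of_bool (bit ((2::nat) ^ k) i)) = (\<Sum>i<m. if i = k then a i else 0)"
    by (intro sum.cong) (auto simp: bit_exp_iff)
  then show ?thesis
    using assms by (simp add: affine_word_def)
qed

lemma card_UNIV_bit: "card (UNIV :: bit set) = 2"
proof -
  have "card (UNIV :: bit set) = card {0, 1 :: bit}"
    using bit_cases by (intro arg_cong[where f = card]) auto
  also have "\<dots> = 2"
    by simp
  finally show ?thesis .
qed

lemma card_RM1: "card (RM1 m) = 2 * 2 ^ m"
proof -
  \<comment> \<open>Extensional functions on the first \<open>m\<close> indices make the
    parametrisation injective.\<close>
  let ?D = "(PiE {..<m} (\<lambda>_. UNIV :: bit set)) \<times> (UNIV :: bit set)"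
  have "RM1 m = (\<lambda>(a, b). affine_word m a b) ` ?D"
  proof (intro equalityI subsetI)
    fix c
    assume "c \<in> RM1 m"
    then obtain a b where c: "c = affine_word m a b"
      by (auto simp: RM1_eq)
    also have "affine_word m a b = affine_word m (restrict a {..<m}) b"
      by (simp add: affine_word_def)
    finally show "c \<in> (\<lambda>(a, b). affine_word m a b) ` ?D"
      by (intro image_eqI[where x = "(restrict a {..<m}, b)"]) auto
  next
    fix c
    assume "c \<in> (\<lambda>(a, b). affine_word m a b) ` ?D"
    then show "c \<in> RM1 m"
      by (rule imageE) (simp only: case_prod_beta affine_word_in_RM1)
  qed
  moreover have "inj_on (\<lambda>(a, b). affine_word m a b) ?D"
  proof (rule inj_onI)
    fix u v
    assume u: "u \<in> ?D" and v: "v \<in> ?D" and "(\<lambda>(a, b). affine_word m a b) u = (\<lambda>(a, b). affine_word m a b) v"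
    then have eq: "affine_word m (fst u) (snd u) = affine_word m (fst v) (snd v)"
      by (simp only: case_prod_beta)
    have snd: "snd u = snd v"
      using affine_word_at_0[of m "fst u" "snd u"] unfolding eq affine_word_at_0 by (rule sym)
    have "fst u k = fst v k" if "k \<in> {..<m}" for k
    proof -
      have "k < m"
        using that by simp
      then have "snd u + fst u k = snd v + fst v k"
        using affine_word_at_power[of k m "fst u" "snd u"] unfolding eq by (simp only: affine_word_at_power)
      then show ?thesis
        unfolding snd by (rule add_left_imp_eq)
    qed
    then have "fst u = fst v"
      by (rule PiE_ext[OF mem_Times_iff[THEN iffD1, THEN conjunct1, OF u] mem_Times_iff[THEN iffD1, THEN conjunct1, OF v]])
    with snd show "u = v"
      by (rule prod_eqI[rotated])
  qed
  ultimately show ?thesis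
    by (simp add: card_image card_cartesian_product card_PiE card_UNIV_bit)
qed

text \<open>Different positions differ in a binary digit, necessarily below \<open>m\<close>; the
  corresponding coordinate function separates them.\<close>

lemma RM1_separates:
  assumes "j < 2 ^ m" "k < 2 ^ m" "j \<noteq> k"
  obtains c where "c \<in> RM1 m" "c $ j \<noteq> c $ k"
proof -
  have high: "\<not> bit l i" if "l < 2 ^ m" "i \<ge> m" for l i :: nat
  proof -
    have "l < 2 ^ i"
      using that by (meson less_le_trans one_le_numeral power_increasing)
    then show ?thesis
      by (simp add: bit_iff_odd)
  qed
  obtain i where i: "bit j i \<noteq> bit k i"
    using assms(3) bit_eq_iff by blast
  then have "i < m"
    using high assms by (meson not_le)
  define c where "c = affine_word m (\<lambda>k. of_bool (k = i)) 0"
  have "c $ l = of_bool (bit l i)" if "l < 2 ^ m" for l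
  proof -
    have "(\<Sum>k<m. of_bool (k = i) * of_bool (bit l k) :: bit) = (\<Sum>k<m. if k = i then of_bool (bit l k) else 0)"
      by (intro sum.cong) auto
    then show ?thesis
      using that \<open>i < m\<close> unfolding c_def affine_word_def by simp
  qed
  then have "c $ j \<noteq> c $ k"
    using assms i by auto
  then show thesis
    using that[of c] by (simp add: c_def)
qed

lemma vec_add_self: "c \<in> carrier_vec n \<Longrightarrow> c + c = 0\<^sub>v n" for c :: "bit vec"
  by (rule eq_vecI) auto

lemma vec_add_add_self: "x \<in> carrier_vec n \<Longrightarrow> c \<in> carrier_vec n \<Longrightarrow> (x + c) + c = x" for c :: "bit vec"
  by (simp add: vec_add_self)

lemma RM1_coset_carrier: "B \<in> RM1_cosets m \<Longrightarrow> B \<subseteq> carrier_vec (2 ^ m)"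
  using RM1_carrier by (fastforce simp: RM1_cosets_def)

lemma RM1_in_cosets: "RM1 m \<in> RM1_cosets m"
proof -
  have "(\<lambda>c. 0\<^sub>v (2 ^ m) + c) ` RM1 m = RM1 m"
    using RM1_carrier[of m] by (intro trans[OF image_cong image_ident]) auto
  then show ?thesis
    unfolding RM1_cosets_def by (metis (mono_tags, lifting) mem_Collect_eq zero_carrier_vec)
qed

text \<open>Every element represents its coset, because \<open>RM1 m\<close> is closed under
  addition and each word is its own inverse. Disjointness of cosets follows.\<close>

lemma RM1_coset_eq:
  assumes "B \<in> RM1_cosets m" "x \<in> B"
  shows "B = (\<lambda>c. x + c) ` RM1 m"
proof -
  obtain u where u: "u \<in> carrier_vec (2 ^ m)" "B = (\<lambda>c. u + c) ` RM1 m"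
    using assms by (auto simp: RM1_cosets_def)
  then obtain c where c: "c \<in> RM1 m" "x = u + c"
    using assms by auto
  have cc: "c \<in> carrier_vec (2 ^ m)"
    using c RM1_carrier by auto
  show ?thesis
  proof (intro equalityI subsetI)
    fix y
    assume "y \<in> B"
    then obtain c' where c': "c' \<in> RM1 m" "y = u + c'"
      using u by auto
    have "y = x + (c + c')"
      using c c' cc u RM1_carrier by (intro eq_vecI) (auto simp: subset_iff)
    then show "y \<in> (\<lambda>c. x + c) ` RM1 m"
      using RM1_add[OF c(1) c'(1)] by auto
  next
    fix y
    assume "y \<in> (\<lambda>c. x + c) ` RM1 m"
    then obtain c' where c': "c' \<in> RM1 m" "y = x + c'"
      by auto
    have "y = u + (c + c')"
      using c c' cc u RM1_carrier by (auto simp: subset_iff)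
    then show "y \<in> B"
      using RM1_add[OF c(1) c'(1)] u by auto
  qed
qed

lemma RM1_coset_add:
  assumes "B \<in> RM1_cosets m" "x \<in> B" "c \<in> RM1 m"
  shows "x + c \<in> B"
  by (subst RM1_coset_eq[OF assms(1,2)]) (rule imageI[OF assms(3)])

lemma card_RM1_coset:
  assumes "B \<in> RM1_cosets m"
  shows "card B = 2 * 2 ^ m"
proof -
  obtain u where u: "u \<in> carrier_vec (2 ^ m)" "B = (\<lambda>c. u + c) ` RM1 m"
    using assms by (auto simp: RM1_cosets_def)
  have "inj_on (\<lambda>c. u + c) (RM1 m)"
  proof (rule inj_on_inverseI[where g = "\<lambda>c. u + c"])
    fix c
    assume "c \<in> RM1 m"
    then have "c \<in> carrier_vec (2 ^ m)"
      using RM1_carrier by auto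
    then show "u + (u + c) = c"
      using u by (simp add: vec_add_self flip: assoc_add_vec)
  qed
  then show ?thesis
    using u by (simp add: card_image card_RM1)
qed

section \<open>Sign vectors of binary words\<close>

definition word_sign :: "bit vec \<Rightarrow> nat \<Rightarrow> real" where
  "word_sign x j = (if x $ j = 0 then 1 else -1)"

text \<open>Two words and two positions are allowed, to compare either two words at one position or
  one word at two positions.\<close>

lemma word_sign_neq_iff: "word_sign y k = - word_sign x j \<longleftrightarrow> x $ j \<noteq> y $ k"
  using bit_cases[of "x $ j"] bit_cases[of "y $ k"] by (auto simp: word_sign_def)

lemma word_sign_mult_eq_1_iff: "word_sign x j * word_sign x k = 1 \<longleftrightarrow> x $ j = x $ k"
  using bit_cases[of "x $ j"] bit_cases[of "x $ k"] by (auto simp: word_sign_def)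

lemma word_sign_add:
  assumes "x \<in> carrier_vec n" "c \<in> carrier_vec n" "j < n"
  shows "word_sign (x + c) j = word_sign x j * word_sign c j"
  using assms bit_cases[of "x $ j"] bit_cases[of "c $ j"] by (auto simp: word_sign_def)

lemma sum_word_sign:
  assumes "x \<in> carrier_vec n"
  shows "(\<Sum>j<n. word_sign x j * word_sign y j) = real n - 2 * real (hamming_dist x y)"
proof -
  have "(\<Sum>j<n. word_sign x j * word_sign y j) = (\<Sum>j<n. 1 - 2 * of_bool (x $ j \<noteq> y $ j))"
  proof (rule sum.cong)
    fix j
    show "word_sign x j * word_sign y j = 1 - 2 * of_bool (x $ j \<noteq> y $ j)"
      using bit_cases[of "x $ j"] bit_cases[of "y $ j"] by (auto simp: word_sign_def)
  qed auto
  also have "\<dots> = real n - 2 * real (card ({..<n} \<inter> {j. x $ j \<noteq> y $ j}))"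
    by (simp add: sum_subtractf flip: sum_distrib_left)
  also have "{..<n} \<inter> {j. x $ j \<noteq> y $ j} = {j. j < dim_vec x \<and> x $ j \<noteq> y $ j}"
    using assms by auto
  finally show ?thesis
    by (simp add: hamming_dist_def)
qed

text \<open>Translation by a word of \<open>RM1 m\<close> that separates \<open>j\<close> from
  \<open>k\<close> permutes the coset and negates every summand.\<close>

lemma sum_word_sign_coset:
  assumes B: "B \<in> RM1_cosets m" and jk: "j < 2 ^ m" "k < 2 ^ m" "j \<noteq> k"
  shows "(\<Sum>y\<in>B. word_sign y j * word_sign y k) = 0"
proof -
  obtain c where c: "c \<in> RM1 m" "c $ j \<noteq> c $ k"
    using RM1_separates jk by blast
  have cc: "c \<in> carrier_vec (2 ^ m)"
    using c RM1_carrier by blast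
  have carrier: "y \<in> carrier_vec (2 ^ m)" if "y \<in> B" for y
    using that B RM1_coset_carrier by blast
  have "bij_betw (\<lambda>y. y + c) B B"
    by (rule bij_betwI[where g = "\<lambda>y. y + c"])
       (use B c(1) cc RM1_coset_add carrier vec_add_add_self[of _ "2 ^ m" c] in \<open>auto simp del: assoc_add_vec\<close>)
  then have "(\<Sum>y\<in>B. word_sign y j * word_sign y k) = (\<Sum>y\<in>B. word_sign (y + c) j * word_sign (y + c) k)"
    by (rule sum.reindex_bij_betw[symmetric])
  also have "\<dots> = (\<Sum>y\<in>B. - (word_sign y j * word_sign y k))"
  proof (rule sum.cong)
    fix y
    assume "y \<in> B"
    then show "word_sign (y + c) j * word_sign (y + c) k = - (word_sign y j * word_sign y k)"
      using jk c cc carrier word_sign_neq_iff[of c k c j]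
      by (simp add: word_sign_add) (simp add: word_sign_def split: if_splits)
  qed simp
  finally show ?thesis
    by (simp add: sum_negf)
qed

section \<open>Deleting a coordinate\<close>

lemma card_delete_index:
  assumes "p < N"
  shows "card {j. j < N \<and> Q j} = card {j. j < N - 1 \<and> Q (insert_index p j)} + of_bool (Q p)"
proof -
  have "{j. j < N \<and> Q j} =
      insert_index p ` {j. j < N - 1 \<and> Q (insert_index p j)} \<union> (if Q p then {p} else {})"
    (is "?L = ?I \<union> ?R")
  proof (intro equalityI subsetI)
    fix j
    assume j: "j \<in> ?L"
    show "j \<in> ?I \<union> ?R"
    proof (cases "j = p")
      case False
      define d where "d = delete_index p j"
      have d: "insert_index p d = j"
        using False by (simp add: d_def insert_delete_index)
      have "d < N - 1"
        using False j assms by (auto simp: d_def delete_index_def)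
      with d j have "insert_index p d \<in> ?I"
        by (intro imageI) simp
      with d show ?thesis
        by simp
    qed (use j in auto)
  next
    fix j
    assume "j \<in> ?I \<union> ?R"
    then show "j \<in> ?L"
      using assms by (auto simp: insert_index_def split: if_splits)
  qed
  moreover have "?I \<inter> ?R = {}"
    using insert_index_exclude[THEN not_sym] by auto
  moreover have "card ?I = card {j. j < N - 1 \<and> Q (insert_index p j)}"
    by (intro card_image insert_index_inj_on)
  ultimately show ?thesis
    by (simp add: card_Un_disjoint)
qed

lemma hamming_dist_delete_coord:
  assumes "x \<in> carrier_vec N" "y \<in> carrier_vec N" "p < N"
  shows "hamming_dist x y = hamming_dist (delete_coord p x) (delete_coord p y) + of_bool (x $ p \<noteq> y $ p)"
proof -
  have "{j. j < N - 1 \<and> delete_coord p x $ j \<noteq> delete_coord p y $ j} =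
      {j. j < N - 1 \<and> x $ insert_index p j \<noteq> y $ insert_index p j}"
    using assms by (auto simp: delete_coord_def)
  then show ?thesis
    using card_delete_index[OF assms(3), of "\<lambda>j. x $ j \<noteq> y $ j"] assms
    by (simp add: hamming_dist_def delete_coord_def)
qed

lemma hamming_weight_delete_coord:
  assumes "x \<in> carrier_vec N" "p < N"
  shows "hamming_weight x = hamming_weight (delete_coord p x) + of_bool (x $ p \<noteq> 0)"
proof -
  have "{j. j < N - 1 \<and> delete_coord p x $ j \<noteq> 0} = {j. j < N - 1 \<and> x $ insert_index p j \<noteq> 0}"
    using assms by (auto simp: delete_coord_def)
  then show ?thesis
    using card_delete_index[OF assms(2), of "\<lambda>j. x $ j \<noteq> 0"] assms
    by (simp add: hamming_weight_def delete_coord_def)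
qed

section \<open>Kerdock codes\<close>

text \<open>The added all-ones word lies in \<open>RM1 m\<close>, so complements stay in the same
  coset.\<close>

definition complement :: "nat \<Rightarrow> bit vec \<Rightarrow> bit vec" where
  "complement m x = x + affine_word m (\<lambda>_. 0) 1"

lemma word_sign_complement:
  assumes "x \<in> carrier_vec (2 ^ m)" "j < 2 ^ m"
  shows "word_sign (complement m x) j = - word_sign x j"
proof -
  have "affine_word m (\<lambda>_. 0) 1 $ j = 1"
    using assms by (simp add: affine_word_def)
  then have "word_sign (affine_word m (\<lambda>_. 0) 1) j = - 1"
    by (simp add: word_sign_def)
  then show ?thesis
    using word_sign_add[OF assms(1) affine_word_carrier assms(2)] by (simp add: complement_def)
qed

lemma min_distance_le: "x \<in> C \<Longrightarrow> y \<in> C \<Longrightarrow> x \<noteq> y \<Longrightarrow> min_distance C \<le> hamming_dist x y"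
  unfolding min_distance_def by (rule Least_le) auto

lemma kerdock_dist_double:
  assumes "even m" "m \<ge> 4"
  shows "2 * kerdock_dist m + 2 ^ (m div 2) = 2 ^ m"
proof -
  have "(2::nat) ^ (m div 2) \<le> 2 ^ m"
    by (intro power_increasing) auto
  moreover have "even ((2::nat) ^ m - 2 ^ (m div 2))"
    using assms by auto
  ultimately show ?thesis
    by (simp add: kerdock_dist_def)
qed

lemma kerdock_sign_system:
  assumes kerdock: "kerdock_code m K" and pq: "p < 2 ^ m" "q < 2 ^ m" "p \<noteq> q"
  obtains P where
    "sign_system_pair (2 ^ m) (2 ^ (m div 2)) K P word_sign (complement m) p q"
    "RM1 m \<in> P" "K \<subseteq> carrier_vec (2 ^ m)"
proof -
  obtain S where S: "S \<subseteq> RM1_cosets m - {RM1 m}" "card S = 2 ^ (m - 1) - 1" "K = RM1 m \<union> \<Union> S"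
    and m: "even m" "m \<ge> 4" and dist: "min_distance K = kerdock_dist m"
    using kerdock unfolding kerdock_code_def by auto
  define P where "P = insert (RM1 m) S"
  have P: "B \<in> RM1_cosets m" if "B \<in> P" for B
    using that S RM1_in_cosets by (auto simp: P_def)
  have K: "\<Union> P = K"
    by (simp add: P_def S)
  have carrier: "K \<subseteq> carrier_vec (2 ^ m)"
    using P RM1_coset_carrier unfolding K[symmetric] by blast
  \<comment> \<open>Since infinite sets have \<open>card\<close> 0, finiteness of \<open>S\<close>
    is obtained from \<open>2 ^ (m - 1) - 1 > 0\<close>.\<close>
  have "(2::nat) ^ 1 \<le> 2 ^ (m - 1)"
    using m by (intro power_increasing) auto
  then have card_S: "card S > 0"
    using S by simp
  then have finite_P: "finite P"
    by (simp add: P_def card_gt_0_iff)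
  have "card P = 2 ^ (m - 1)"
    using S card_S card_gt_0_iff[of S] unfolding P_def by (subst card_insert_disjoint) auto
  then have card_P: "2 * card P = 2 ^ m"
    using m by (simp flip: power_Suc)
  \<comment> \<open>The minimum distance applied to \<open>x\<close> and \<open>y\<close> bounds the
    sum above; applied to the complement of \<open>x\<close> and \<open>y\<close> it bounds the sum
    below.\<close>
  have dot: "\<bar>\<Sum>j<2 ^ m. word_sign x j * word_sign y j\<bar> \<le> 2 ^ (m div 2)"
    if xy: "x \<in> K" "y \<in> K" "y \<noteq> x" "y \<noteq> complement m x" for x y
  proof -
    obtain B where "B \<in> P" "x \<in> B"
      using xy K by blast
    then have "complement m x \<in> B"
      unfolding complement_def using P by (intro RM1_coset_add) auto
    then have "complement m x \<in> K"
      using K \<open>B \<in> P\<close> by blast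
    then have "kerdock_dist m \<le> hamming_dist x y" "kerdock_dist m \<le> hamming_dist (complement m x) y"
      unfolding dist[symmetric] using xy by (auto intro!: min_distance_le)
    moreover have "(\<Sum>j<2 ^ m. word_sign (complement m x) j * word_sign y j) =
        - (\<Sum>j<2 ^ m. word_sign x j * word_sign y j)"
      unfolding sum_negf[symmetric] using xy carrier
      by (intro sum.cong) (auto simp: word_sign_complement subset_iff)
    moreover have "x \<in> carrier_vec (2 ^ m)" "complement m x \<in> carrier_vec (2 ^ m)"
      using xy carrier \<open>complement m x \<in> K\<close> by auto
    moreover have "real (2 ^ m) = 2 * real (kerdock_dist m) + 2 ^ (m div 2)"
      unfolding kerdock_dist_double[OF m, symmetric] by simp
    ultimately show ?thesis
      using sum_word_sign[of x "2 ^ m" y] sum_word_sign[of "complement m x" "2 ^ m" y]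
      by linarith
  qed
  have "sign_system_pair (2 ^ m) (2 ^ (m div 2)) K P word_sign (complement m) p q"
  proof unfold_locales
    show "2 ^ (m div 2) * 2 ^ (m div 2) = real (2 ^ m)"
      using m by (simp flip: power_add mult_2)
    have "(2::real) ^ 2 \<le> 2 ^ (m div 2)"
      using m by (intro power_increasing) auto
    then show "(4::real) \<le> 2 ^ (m div 2)"
      by simp
    show "finite K"
      unfolding K[symmetric]
    proof (rule finite_Union[OF finite_P])
      fix B
      assume "B \<in> P"
      then have "card B > 0"
        using card_RM1_coset[OF P] by simp
      then show "finite B"
        by (rule card_ge_0_finite)
    qed
    show "A = B" if "A \<in> P" "B \<in> P" "x \<in> A" "x \<in> B" for A B x
      using RM1_coset_eq[OF P[OF that(1)] that(3)] RM1_coset_eq[OF P[OF that(2)] that(4)]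
      by (rule trans[OF _ sym])
    show "complement m x \<in> B" if "B \<in> P" "x \<in> B" for B x
      unfolding complement_def by (rule RM1_coset_add[OF P[OF that(1)] that(2) affine_word_in_RM1])
    show "complement m (complement m x) = x" if "x \<in> K" for x
      using that carrier affine_word_carrier unfolding complement_def by (intro vec_add_add_self) auto
    show "word_sign (complement m x) j = - word_sign x j" if "x \<in> K" "j < 2 ^ m" for x j
      using that carrier by (intro word_sign_complement) auto
    show "card B = 2 * 2 ^ m" if "B \<in> P" for B
      by (rule card_RM1_coset[OF P[OF that]])
    show "(\<Sum>y\<in>B. word_sign y j * word_sign y k) = 0"
      if "B \<in> P" "j < 2 ^ m" "k < 2 ^ m" "j \<noteq> k" for B j k
      by (rule sum_word_sign_coset[OF P[OF that(1)] that(2-4)])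
    show "word_sign x j = 1 \<or> word_sign x j = -1" for x j
      by (simp add: word_sign_def)
  qed (fact K card_P dot pq)+
  then show thesis
    using that carrier by (simp add: P_def)
qed

section \<open>The graph of the punctured code\<close>

locale punctured_kerdock =
  fixes m p i :: nat and K :: "bit vec set"
  assumes kerdock: "kerdock_code m K" and p_less: "p < 2 ^ m" and i_less: "i < 2 ^ m - 1"
begin

text \<open>The position of \<open>K\<close> that becomes position \<open>i\<close> once
  \<open>p\<close> is deleted.\<close>

definition q where "q = insert_index p i"

lemma q_less: "q < 2 ^ m" and p_neq_q: "p \<noteq> q"
  using p_less i_less by (auto simp: q_def insert_index_def)

lemma m: "even m" "m \<ge> 4"
  using kerdock by (auto simp: kerdock_code_def)

text \<open>\<open>kerdock_code\<close> only asserts that a family of cosets exists; a fixed choice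
  is needed to instantiate the locale.\<close>

definition P where
  "P = (SOME P. sign_system_pair (2 ^ m) (2 ^ (m div 2)) K P word_sign (complement m) p q \<and> RM1 m \<in> P)"

lemma sign_system: "sign_system_pair (2 ^ m) (2 ^ (m div 2)) K P word_sign (complement m) p q"
  and RM1_in_P: "RM1 m \<in> P"
proof -
  have "\<exists>P. sign_system_pair (2 ^ m) (2 ^ (m div 2)) K P word_sign (complement m) p q \<and> RM1 m \<in> P"
    using kerdock_sign_system[OF kerdock p_less q_less p_neq_q] by metis
  from someI_ex[OF this]
  show "sign_system_pair (2 ^ m) (2 ^ (m div 2)) K P word_sign (complement m) p q" "RM1 m \<in> P"
    by (simp_all add: P_def)
qed

sublocale sign_system_pair "2 ^ m" "2 ^ (m div 2)" K P word_sign "complement m" p q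
  by (rule sign_system)

lemma carrier: "x \<in> K \<Longrightarrow> x \<in> carrier_vec (2 ^ m)"
  using kerdock_sign_system[OF kerdock p_less q_less p_neq_q] by blast

abbreviation "del \<equiv> delete_coord p"
abbreviation "C \<equiv> puncture p K"

lemma ip_hamming_dist:
  assumes "x \<in> K"
  shows "ip x y = 2 ^ m - 2 * real (hamming_dist x y)"
  using sum_word_sign[OF carrier[OF assms], of y] by (simp add: ip_def)

lemma kerdock_dist_ge_2: "kerdock_dist m \<ge> 2"
proof -
  have "(2::nat) ^ (m div 2 + 2) \<le> 2 ^ m"
    using m by (intro power_increasing) auto
  moreover have "(2::nat) ^ 2 \<le> 2 ^ (m div 2)"
    using m by (intro power_increasing) auto
  ultimately show ?thesis
    using kerdock_dist_double[OF m] by (simp add: power_add)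
qed

lemma hamming_dist_ge: "x \<in> K \<Longrightarrow> y \<in> K \<Longrightarrow> x \<noteq> y \<Longrightarrow> hamming_dist x y \<ge> kerdock_dist m"
  using min_distance_le[of x K y] kerdock by (simp add: kerdock_code_def)

lemma hamming_dist_del:
  assumes "x \<in> K" "y \<in> K"
  shows "hamming_dist x y = hamming_dist (del x) (del y) + of_bool (x $ p \<noteq> y $ p)"
  using assms p_less carrier by (intro hamming_dist_delete_coord) auto

text \<open>Words with the same image differ at most at \<open>p\<close>, but distinct codewords
  have distance at least 2.\<close>

lemma inj_del: "inj_on del K"
proof (rule inj_onI, rule ccontr)
  fix x y
  assume "x \<in> K" "y \<in> K" "del x = del y" "x \<noteq> y"
  then have "hamming_dist x y \<le> 1" "hamming_dist x y \<ge> 2"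
    using hamming_dist_del[of x y] hamming_dist_ge[of x y] kerdock_dist_ge_2
    by (auto simp: hamming_dist_def[of "del y" "del y"] of_bool_def split: if_splits)
  then show False
    by simp
qed

lemma del_index:
  assumes "x \<in> K"
  shows "del x $ i = x $ q"
  using carrier[OF assms] i_less by (simp add: delete_coord_def q_def)

lemma adj_iff:
  assumes "x \<in> K" "y \<in> K"
  shows "(x, y) \<in> adj \<longleftrightarrow> hamming_dist x y = kerdock_dist m \<and> x $ p \<noteq> y $ p \<and> x $ q \<noteq> y $ q"
proof -
  have "ip x y = 2 ^ (m div 2) \<longleftrightarrow>
      real (2 ^ m) = real (2 ^ (m div 2) + 2 * hamming_dist x y)"
    using assms by (auto simp: ip_hamming_dist)
  also have "\<dots> \<longleftrightarrow> hamming_dist x y = kerdock_dist m"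
    unfolding of_nat_eq_iff kerdock_dist_double[OF m, symmetric] by auto
  finally show ?thesis
    using assms by (simp add: adj_def word_sign_neq_iff)
qed

text \<open>Deletion lowers a distance by at most one, and does so for a pair in \<open>adj\<close>,
  which differs at \<open>p\<close>.\<close>

lemma min_distance_puncture: "min_distance C = kerdock_dist m - 1"
  unfolding min_distance_def
proof (rule Least_equality)
  obtain x where x: "x \<in> RM1 m"
    using zero_in_RM1 by blast
  then have "x \<in> K"
    using RM1_in_P block_subset by auto
  then obtain y where y: "(x, y) \<in> adj"
    using exists_neighbour by blast
  then have K: "x \<in> K" "y \<in> K"
    by (auto simp: adj_def)
  then have eq: "hamming_dist x y = kerdock_dist m" "x $ p \<noteq> y $ p"
    using y adj_iff by auto
  then have "hamming_dist (del x) (del y) = kerdock_dist m - 1"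
    using K hamming_dist_del[of x y] by simp
  moreover have "del x \<noteq> del y"
    using K eq inj_del by (auto dest: inj_onD)
  ultimately show "\<exists>x\<in>C. \<exists>y\<in>C. x \<noteq> y \<and> hamming_dist x y = kerdock_dist m - 1"
    using K by (auto simp: puncture_def)
next
  fix k
  assume "\<exists>x\<in>C. \<exists>y\<in>C. x \<noteq> y \<and> hamming_dist x y = k"
  then obtain x y where "x \<in> K" "y \<in> K" "x \<noteq> y" "hamming_dist (del x) (del y) = k"
    by (auto simp: puncture_def)
  then show "kerdock_dist m - 1 \<le> k"
    using hamming_dist_ge[of x y] hamming_dist_del[of x y] by (auto simp: of_bool_def split: if_splits)
qed

lemma i_edges_iff:
  assumes "x \<in> K" "y \<in> K"
  shows "(del x, del y) \<in> i_edges i C \<longleftrightarrow> (x, y) \<in> adj"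
proof -
  have "(del x, del y) \<in> i_edges i C \<longleftrightarrow>
      hamming_dist (del x) (del y) = kerdock_dist m - 1 \<and> x $ q \<noteq> y $ q"
    using assms by (simp add: i_edges_def min_distance_puncture del_index) (auto simp: puncture_def)
  also have "\<dots> \<longleftrightarrow> hamming_dist x y = kerdock_dist m \<and> x $ p \<noteq> y $ p \<and> x $ q \<noteq> y $ q"
    \<comment> \<open>The bound \<open>kerdock_dist_ge_2\<close> rules out \<open>x = y\<close>,
      whose distance 0 could otherwise equal \<open>kerdock_dist m - 1\<close>.\<close>
    using assms hamming_dist_ge[of x y] hamming_dist_del[of x y] kerdock_dist_ge_2
    by (cases "x = y"; cases "x $ p = y $ p") auto
  finally show ?thesis
    using assms by (simp add: adj_iff)
qed

lemma i_edges_rtrancl: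
  assumes "x \<in> K" "y \<in> K"
  shows "(del x, del y) \<in> (i_edges i C)\<^sup>* \<longleftrightarrow> word_sign x p * word_sign x q = word_sign y p * word_sign y q"
proof
  assume "word_sign x p * word_sign x q = word_sign y p * word_sign y q"
  with assms have "(x, y) \<in> adj\<^sup>*"
    by (rule reach)
  then show "(del x, del y) \<in> (i_edges i C)\<^sup>*"
  proof (induction rule: rtrancl_induct)
    case (step y z)
    then have "(del y, del z) \<in> i_edges i C"
      using i_edges_iff by (auto simp: adj_def)
    with step show ?case
      by auto
  qed auto
next
  \<comment> \<open>Paths are lifted edge by edge to \<open>K\<close>; afterwards injectivity of
    \<open>del\<close> identifies the lifted endpoint.\<close>
  have "\<exists>y\<in>K. v = del y \<and> (x, y) \<in> adj\<^sup>*" if "(del x, v) \<in> (i_edges i C)\<^sup>*" for v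
    using that
  proof (induction rule: rtrancl_induct)
    case base
    then show ?case
      using assms by auto
  next
    case (step v w)
    then obtain y where y: "y \<in> K" "v = del y" "(x, y) \<in> adj\<^sup>*"
      by auto
    have "w \<in> C"
      using step by (auto simp: i_edges_def)
    then obtain z where z: "z \<in> K" "w = del z"
      by (auto simp: puncture_def)
    then have "(y, z) \<in> adj"
      using y step i_edges_iff by auto
    then show ?case
      using z rtrancl_into_rtrancl[OF y(3)] by blast
  qed
  moreover assume "(del x, del y) \<in> (i_edges i C)\<^sup>*"
  ultimately have "(x, y) \<in> adj\<^sup>*"
    using assms inj_del by (metis inj_onD)
  then show "word_sign x p * word_sign x q = word_sign y p * word_sign y q"
    by (rule reach_product)
qed

section \<open>The two components\<close>

definition sign_class :: "real \<Rightarrow> bit vec set" where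
  "sign_class r = del ` {x \<in> K. word_sign x p * word_sign x q = r}"

lemma component_eq:
  assumes x: "x \<in> K"
  shows "(i_edges i C)\<^sup>* `` {del x} = sign_class (word_sign x p * word_sign x q)"
proof -
  have "v \<in> C" if "(del x, v) \<in> (i_edges i C)\<^sup>*" for v
    using that x by (induction rule: rtrancl_induct) (auto simp: i_edges_def puncture_def)
  then show ?thesis
    using x i_edges_rtrancl by (fastforce simp: sign_class_def puncture_def)
qed

text \<open>A component depends only on the sign product at \<open>p\<close> and \<open>q\<close>,
  and \<open>RM1 m\<close> alone realises both values.\<close>

lemma i_components_eq: "i_components i C = {sign_class 1, sign_class (-1)}"
proof -
  obtain x y where x: "x \<in> RM1 m" "word_sign x p * word_sign x q = 1"
    and y: "y \<in> RM1 m" "word_sign y p * word_sign y q = -1"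
    by (rule exists_product[OF RM1_in_P])
  have K: "x \<in> K" "y \<in> K"
    using x y block_subset[OF RM1_in_P] by auto
  have "i_components i C = (\<lambda>v. (i_edges i C)\<^sup>* `` {v}) ` del ` K"
    unfolding i_components_def quotient_def puncture_def by blast
  also have "\<dots> = (\<lambda>x. sign_class (word_sign x p * word_sign x q)) ` K"
    unfolding image_image by (rule image_cong[OF refl component_eq])
  also have "\<dots> = {sign_class 1, sign_class (-1)}"
  proof
    show "(\<lambda>x. sign_class (word_sign x p * word_sign x q)) ` K \<subseteq> {sign_class 1, sign_class (-1)}"
    proof (rule image_subsetI)
      fix x
      have "word_sign x p * word_sign x q = 1 \<or> word_sign x p * word_sign x q = -1"
        by (simp add: word_sign_def)
      then show "sign_class (word_sign x p * word_sign x q) \<in> {sign_class 1, sign_class (-1)}"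
        by (elim disjE) simp_all
    qed
    have "sign_class 1 \<in> (\<lambda>x. sign_class (word_sign x p * word_sign x q)) ` K"
      by (rule image_eqI[OF _ K(1)]) (simp only: x)
    moreover have "sign_class (-1) \<in> (\<lambda>x. sign_class (word_sign x p * word_sign x q)) ` K"
      by (rule image_eqI[OF _ K(2)]) (simp only: y)
    ultimately show "{sign_class 1, sign_class (-1)} \<subseteq> (\<lambda>x. sign_class (word_sign x p * word_sign x q)) ` K"
      by (simp only: insert_subset empty_subsetI simp_thms)
  qed
  finally show ?thesis .
qed

lemma sign_class_neq: "sign_class 1 \<noteq> sign_class (-1)"
proof
  obtain x where "x \<in> RM1 m" and "word_sign x p * word_sign x q = 1"
    by (rule exists_product[OF RM1_in_P])
  then have x: "x \<in> K" "word_sign x p * word_sign x q = 1"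
    using block_subset[OF RM1_in_P] by auto
  assume "sign_class 1 = sign_class (-1)"
  moreover have "del x \<in> sign_class 1"
    using x by (auto simp: sign_class_def)
  ultimately obtain y where "y \<in> K" "word_sign y p * word_sign y q = -1" "del x = del y"
    by (auto simp: sign_class_def)
  then show False
    using x inj_onD[OF inj_del] by fastforce
qed

text \<open>The weight is half of the length minus the inner product with the zero word. By
  \<open>ip_values\<close> this is even, as the length and its square root are multiples of
  four.\<close>

lemma even_weight:
  assumes "x \<in> K"
  shows "even (hamming_weight x)"
proof -
  have z: "0\<^sub>v (2 ^ m) \<in> K"
    using zero_in_RM1 RM1_in_P block_subset by auto
  have "hamming_dist (0\<^sub>v (2 ^ m)) x = hamming_weight x"
    using carrier[OF assms] by (auto simp: hamming_dist_def hamming_weight_def intro!: arg_cong[where f = card])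
  then have ip: "ip (0\<^sub>v (2 ^ m)) x = 2 ^ m - 2 * real (hamming_weight x)"
    using ip_hamming_dist[OF z] by simp
  obtain c where c: "m = 3 + c"
    using m le_Suc_ex[of 3 m] by auto
  have a: "(2::nat) ^ m = 4 * (2 * 2 ^ c)"
    unfolding c power_add by simp
  have "2 \<le> m div 2"
    using m by simp
  then obtain c' where c': "m div 2 = 2 + c'"
    using le_Suc_ex by blast
  have b: "(2::nat) ^ (m div 2) = 4 * 2 ^ c'"
    unfolding c' power_add by simp
  \<comment> \<open>Naming the quotients hides the powers and leaves linear arithmetic.\<close>
  obtain a b :: nat where ab: "2 ^ m = 4 * a" "2 ^ (m div 2) = 4 * b" "even a"
    by (rule that[OF a b]) simp
  have "(2::real) ^ m = 4 * real a" "(2::real) ^ (m div 2) = 4 * real b"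
    using arg_cong[OF ab(1), of real] arg_cong[OF ab(2), of real] by simp_all
  note real_ab = this
  have "ip (0\<^sub>v (2 ^ m)) x = 4 * real a \<or> ip (0\<^sub>v (2 ^ m)) x = - 4 * real a \<or> ip (0\<^sub>v (2 ^ m)) x = 0 \<or>
      ip (0\<^sub>v (2 ^ m)) x = 4 * real b \<or> ip (0\<^sub>v (2 ^ m)) x = - 4 * real b"
    using ip_values[OF z assms] by (simp add: real_ab)
  then have "hamming_weight x = 0 \<or> hamming_weight x = 4 * a \<or> hamming_weight x = 2 * a \<or>
      hamming_weight x + 2 * b = 2 * a \<or> hamming_weight x = 2 * a + 2 * b"
    unfolding ip real_ab by linarith
  then show ?thesis
    by presburger
qed

text \<open>The total weight is even, so the remaining weight is even exactly when the two deleted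
  bits agree.\<close>

lemma even_weight_delete_iff:
  assumes "x \<in> K"
  shows "even (hamming_weight (delete_coord i (del x))) \<longleftrightarrow> word_sign x p * word_sign x q = 1"
proof -
  have "del x \<in> carrier_vec (2 ^ m - 1)"
    using carrier[OF assms] by (intro carrier_vecI) (simp add: delete_coord_def)
  then have "hamming_weight x = hamming_weight (delete_coord i (del x))
      + of_bool (x $ q \<noteq> 0) + of_bool (x $ p \<noteq> 0)"
    using hamming_weight_delete_coord[OF carrier[OF assms] p_less] hamming_weight_delete_coord[of "del x" "2 ^ m - 1" i]
      i_less del_index[OF assms] by simp
  then show ?thesis
    using even_weight[OF assms] bit_cases[of "x $ p"] bit_cases[of "x $ q"]
    by (auto simp: word_sign_mult_eq_1_iff)
qed

end

theorem theorem3: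
  fixes m p i :: nat and K :: "bit vec set"
  assumes "even m" and "m \<ge> 4"
    and "kerdock_code m K"
    and "p < 2 ^ m"
    and "i < 2 ^ m - 1"
  shows "card (i_components i (puncture p K)) = 2 \<and>
    (\<forall>x\<in>puncture p K. \<forall>y\<in>puncture p K.
       (even (hamming_weight (delete_coord i x)) \<longleftrightarrow> even (hamming_weight (delete_coord i y))) \<longrightarrow>
       (\<exists>A\<in>i_components i (puncture p K). x \<in> A \<and> y \<in> A))"
proof -
  interpret punctured_kerdock m p i K
    using assms by unfold_locales
  have "del x \<in> sign_class (if even (hamming_weight (delete_coord i (del x))) then 1 else -1)" if "x \<in> K" for x
    using that even_weight_delete_iff[OF that] by (auto simp: sign_class_def word_sign_def)
  then have mem: "v \<in> sign_class (if even (hamming_weight (delete_coord i v)) then 1 else -1)" if "v \<in> C" for v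
    using that unfolding puncture_def by blast
  show ?thesis
  proof (intro conjI ballI impI)
    show "card (i_components i C) = 2"
      using sign_class_neq by (simp add: i_components_eq)
  next
    fix x y
    assume xy: "x \<in> C" "y \<in> C"
      "even (hamming_weight (delete_coord i x)) \<longleftrightarrow> even (hamming_weight (delete_coord i y))"
    show "\<exists>A\<in>i_components i C. x \<in> A \<and> y \<in> A"
      using mem[OF xy(1)] mem[OF xy(2)] xy(3) unfolding i_components_eq by (auto split: if_splits)
  qed
qed

end
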